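(* Let $m\ge 2$ be an integer, and let $x,y\in\mathbb{C}$ with $\mathrm{Re}(x)>-1$ and $\mathrm{Re}(y)>0$, such that $(k+x)^m+y\neq 0$ for every integer $k\ge 1$. Let $(-1)^{1/m}\in\mathbb{C}$ denote an $m$-th root of $-1$. Then $$\sum_{k=1}^\infty\frac{1}{(k+x)^m+y}=\frac{1}{m}\sum_{\xi\in\mathbb{C},\ \xi^m=1}\xi\,(-1)^{1/m}\,y^{\frac1m-1}\,\Psi\left(x-\xi\,(-1)^{1/m}y^{1/m}+1\right).$$
   Context: $\Psi=\Gamma'/\Gamma$ is the logarithmic derivative of the Gamma function. For $\mathrm{Re}(y)>0$, $y^{1/m}$ is the principal $m$-th root and $y^{\frac1m-1}=y^{1/m}/y$. *)

theory Defs
  imports "HOL-Analysis.Analysis"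
begin

text \<open>
  The logarithmic derivative of the Gamma function is the library's \<^term>\<open>Digamma\<close>, which is
  introduced there by a series; the two agree wherever Gamma is differentiable.
\<close>

lemma Digamma_eq_deriv_Gamma_div_Gamma:
  fixes z :: complex
  assumes "z \<notin> \<int>\<^sub>\<le>\<^sub>0"
  shows "Digamma z = deriv Gamma z / Gamma z"
proof -
  have "(Gamma has_field_derivative Gamma z * Digamma z) (at z)"
    using assms by (rule has_field_derivative_Gamma)
  then have "deriv Gamma z = Gamma z * Digamma z"
    by (rule DERIV_imp_deriv)
  moreover have "Gamma z \<noteq> 0"
    using assms by (simp add: Gamma_eq_zero_iff)
  ultimately show ?thesis
    by simp
qed

end

theory Submission
  imports Defs
begin

text \<open>
  Put \<open>s = \<omega> y\<^sup>1\<^sup>/\<^sup>m\<close>, so that \<open>s ^ m = - y\<close> and the zeros of \<open>t ^ m + y\<close> are the numbers \<open>\<xi> s\<close>, where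
  \<open>\<xi>\<close> runs through the \<open>m\<close>-th roots of unity. The partial fraction decomposition
  (\<open>partial_fractions_nth_roots\<close>) is
  \[ \frac{m s^m}{t^m - s^m} = \sum_\xi \frac{\xi s}{t - \xi s} . \]
  Summed over \<open>t = k + x\<close>, each single term on the right diverges like a harmonic series. Since
  \<open>m \<ge> 2\<close>, the numerators \<open>\<xi> s\<close> add up to zero, so \<open>1 / k\<close> may be subtracted from every
  \<open>1 / (k + x - \<xi> s)\<close> without changing the total. What remains are \<open>m\<close> convergent series, each of
  them the defining series of \<open>Digamma (x - \<xi> s + 1)\<close> up to sign and Euler's constant; that constant
  disappears for the same reason (\<open>sums_inverse_power_diff\<close>). The theorem follows on dividing by
  \<open>s ^ m = - y\<close>, because \<open>s / y = \<omega> y powr (1 / m - 1)\<close>.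
\<close>

text \<open>
  Multiplication by a root of unity \<open>\<zeta>\<close> permutes the \<open>n\<close>-th roots of unity and so multiplies the sum
  by \<open>\<zeta> ^ k\<close> while leaving it unchanged. As \<open>X ^ k - 1\<close> has at most \<open>k < n\<close> zeros, some \<open>\<zeta>\<close> has
  \<open>\<zeta> ^ k \<noteq> 1\<close>.
\<close>
lemma sum_power_roots_unity_eq_0:
  fixes n k :: nat
  assumes "0 < k" and "k < n"
  shows "(\<Sum>\<xi> | \<xi> ^ n = 1. \<xi> ^ k) = (0 :: complex)"
proof -
  have fin: "finite {z :: complex. z ^ k = 1}"
    using assms by (intro finite_roots_unity) auto
  have "card {z :: complex. z ^ k = 1} < card {z :: complex. z ^ n = 1}"
    using assms by (simp add: card_roots_unity_eq)
  then have "\<not> {z :: complex. z ^ n = 1} \<subseteq> {z. z ^ k = 1}"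
    using card_mono[OF fin] by (meson linorder_not_le)
  then obtain \<zeta> :: complex where \<zeta>: "\<zeta> ^ n = 1" "\<zeta> ^ k \<noteq> 1"
    by blast
  then have "\<zeta> \<noteq> 0"
    using assms by (auto simp: power_0_left)
  have "(\<Sum>\<xi> | \<xi> ^ n = 1. \<xi> ^ k) = (\<Sum>\<xi> | \<xi> ^ n = 1. (\<zeta> * \<xi>) ^ k)"
    using \<zeta> \<open>\<zeta> \<noteq> 0\<close>
    by (intro sum.reindex_bij_witness[where i = "\<lambda>\<xi>. \<zeta> * \<xi>" and j = "\<lambda>\<xi>. \<xi> / \<zeta>"])
       (auto simp: power_mult_distrib power_divide)
  also have "\<dots> = \<zeta> ^ k * (\<Sum>\<xi> | \<xi> ^ n = 1. \<xi> ^ k)"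
    by (simp add: power_mult_distrib sum_distrib_left)
  finally show ?thesis
    using \<zeta> by simp
qed

text \<open>
  Since \<open>(\<xi> s) ^ m = s ^ m\<close>, the quotient \<open>(t ^ m - s ^ m) / (t - \<xi> s)\<close> is a finite geometric sum.
  In the sum over \<open>\<xi>\<close> every power of \<open>\<xi>\<close> except \<open>\<xi> ^ m = 1\<close> cancels.
\<close>
lemma partial_fractions_nth_roots:
  fixes m :: nat and s t :: complex
  assumes "m > 0" and neq: "t ^ m \<noteq> s ^ m"
  shows "(\<Sum>\<xi> | \<xi> ^ m = 1. \<xi> * s / (t - \<xi> * s)) = of_nat m * s ^ m / (t ^ m - s ^ m)"
proof -
  have expand: "(t ^ m - s ^ m) * (\<xi> * s / (t - \<xi> * s)) =
      (\<Sum>j<m. (t ^ j * s ^ (m - j)) * \<xi> ^ (m - j))" if \<xi>: "\<xi> ^ m = 1" for \<xi>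
  proof -
    have nz: "t - \<xi> * s \<noteq> 0"
      using neq \<xi> by (auto simp: power_mult_distrib)
    have "t ^ m - s ^ m = t ^ m - (\<xi> * s) ^ m"
      by (simp add: power_mult_distrib \<xi>)
    also have "\<dots> = (t - \<xi> * s) * (\<Sum>j<m. (\<xi> * s) ^ (m - Suc j) * t ^ j)"
      by (rule power_diff_sumr2)
    finally have "(t ^ m - s ^ m) * (\<xi> * s / (t - \<xi> * s)) =
        \<xi> * s * (\<Sum>j<m. (\<xi> * s) ^ (m - Suc j) * t ^ j)"
      using nz by simp
    also have "\<dots> = (\<Sum>j<m. (\<xi> * s) ^ Suc (m - Suc j) * t ^ j)"
      by (simp add: sum_distrib_left mult_ac)
    also have "\<dots> = (\<Sum>j<m. (t ^ j * s ^ (m - j)) * \<xi> ^ (m - j))"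
      by (intro sum.cong refl) (simp add: Suc_diff_Suc power_mult_distrib mult_ac del: power_Suc)
    finally show ?thesis .
  qed
  have "(t ^ m - s ^ m) * (\<Sum>\<xi> | \<xi> ^ m = 1. \<xi> * s / (t - \<xi> * s)) =
      (\<Sum>\<xi> | \<xi> ^ m = 1. \<Sum>j<m. (t ^ j * s ^ (m - j)) * \<xi> ^ (m - j))"
    unfolding sum_distrib_left by (intro sum.cong refl expand) simp
  also have "\<dots> = (\<Sum>j<m. (t ^ j * s ^ (m - j)) * (\<Sum>\<xi> | \<xi> ^ m = 1. \<xi> ^ (m - j)))"
    by (subst sum.swap) (simp add: sum_distrib_left)
  also have "\<dots> = (\<Sum>j<m. if j = 0 then s ^ m * of_nat m else 0)"
    using \<open>m > 0\<close>
    by (intro sum.cong refl) (auto simp: sum_power_roots_unity_eq_0 card_roots_unity_eq)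
  also have "\<dots> = of_nat m * s ^ m"
    using \<open>m > 0\<close> by simp
  finally show ?thesis
    using neq by (simp add: field_simps)
qed

text \<open>
  Because \<open>m \<ge> 2\<close>, the numerators \<open>\<xi> s\<close> add up to zero. This brings in the terms \<open>1 / (k + 1)\<close> that
  turn each partial fraction into a convergent digamma series, and it removes the contributions of
  Euler's constant. By the hypothesis on \<open>(k + x) ^ m\<close>, none of these series contains an inverse of zero.
\<close>
lemma sums_inverse_power_diff:
  fixes m :: nat and s x :: complex
  assumes "m \<ge> 2" and neq: "\<And>k::nat. k \<ge> 1 \<Longrightarrow> (of_nat k + x) ^ m \<noteq> s ^ m"
  shows "(\<lambda>k. of_nat m * s ^ m / ((of_nat (Suc k) + x) ^ m - s ^ m)) sums
    (- (\<Sum>\<xi> | \<xi> ^ m = 1. \<xi> * s * Digamma (x - \<xi> * s + 1)))"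
proof -
  have sum_0: "(\<Sum>\<xi> | \<xi> ^ m = 1. \<xi> * s * c) = 0" for c
    using sum_power_roots_unity_eq_0[of 1 m] \<open>m \<ge> 2\<close> by (simp flip: sum_distrib_right)
  have "(\<lambda>k. \<Sum>\<xi> | \<xi> ^ m = 1. \<xi> * s *
        (inverse (of_nat (Suc k)) - inverse (x - \<xi> * s + 1 + of_nat k))) sums
      (\<Sum>\<xi> | \<xi> ^ m = 1. \<xi> * s * (Digamma (x - \<xi> * s + 1) + euler_mascheroni))"
  proof (intro sums_sum sums_mult)
    fix \<xi> :: complex
    assume "\<xi> \<in> {\<xi>. \<xi> ^ m = 1}"
    then have \<xi>: "(\<xi> * s) ^ m = s ^ m"
      by (simp add: power_mult_distrib)
    have "x - \<xi> * s + 1 \<noteq> 0"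
    proof
      assume "x - \<xi> * s + 1 = 0"
      then have "of_nat 1 + x = \<xi> * s"
        by (simp add: algebra_simps)
      with neq[of 1] \<xi> show False
        by simp
    qed
    from summable_sums[OF summable_Digamma[OF this]]
    show "(\<lambda>k. inverse (of_nat (Suc k)) - inverse (x - \<xi> * s + 1 + of_nat k)) sums
        (Digamma (x - \<xi> * s + 1) + euler_mascheroni)"
      by (simp add: Digamma_def)
  qed
  also have "(\<Sum>\<xi> | \<xi> ^ m = 1. \<xi> * s * (Digamma (x - \<xi> * s + 1) + euler_mascheroni)) =
      (\<Sum>\<xi> | \<xi> ^ m = 1. \<xi> * s * Digamma (x - \<xi> * s + 1))"
    by (simp add: distrib_left sum.distrib sum_0)
  also have "(\<lambda>k. \<Sum>\<xi> | \<xi> ^ m = 1. \<xi> * s *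
        (inverse (of_nat (Suc k)) - inverse (x - \<xi> * s + 1 + of_nat k))) =
      (\<lambda>k. - (of_nat m * s ^ m / ((of_nat (Suc k) + x) ^ m - s ^ m)))"
  proof
    fix k :: nat
    have "(\<Sum>\<xi> | \<xi> ^ m = 1. \<xi> * s *
          (inverse (of_nat (Suc k)) - inverse (x - \<xi> * s + 1 + of_nat k))) =
        - (\<Sum>\<xi> | \<xi> ^ m = 1. \<xi> * s * inverse (x - \<xi> * s + 1 + of_nat k))"
      by (simp add: right_diff_distrib sum_subtractf sum_0 del: of_nat_Suc)
    also have "\<dots> = - (\<Sum>\<xi> | \<xi> ^ m = 1. \<xi> * s / ((of_nat (Suc k) + x) - \<xi> * s))"
      by (simp add: divide_inverse algebra_simps)
    also have "\<dots> = - (of_nat m * s ^ m / ((of_nat (Suc k) + x) ^ m - s ^ m))"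
      using \<open>m \<ge> 2\<close> neq[of "Suc k"] by (subst partial_fractions_nth_roots) auto
    finally show "(\<Sum>\<xi> | \<xi> ^ m = 1. \<xi> * s *
          (inverse (of_nat (Suc k)) - inverse (x - \<xi> * s + 1 + of_nat k))) =
        - (of_nat m * s ^ m / ((of_nat (Suc k) + x) ^ m - s ^ m))" .
  qed
  finally show ?thesis
    using sums_minus by fastforce
qed

theorem corollary1p2:
  fixes m :: nat and x y \<omega> :: complex
  assumes "m \<ge> 2"
    and "Re x > -1"
    and "Re y > 0"
    and "\<And>k::nat. k \<ge> 1 \<Longrightarrow> (of_nat k + x) ^ m + y \<noteq> 0"
    and "\<omega> ^ m = -1"
  shows "(\<lambda>k. 1 / ((of_nat (Suc k) + x) ^ m + y)) sums
    (1 / of_nat m * (\<Sum>\<xi> | \<xi> ^ m = 1.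
      \<xi> * \<omega> * y powr (1 / of_nat m - 1) *
        Digamma (x - \<xi> * \<omega> * y powr (1 / of_nat m) + 1)))"
proof -
  define s where "s = \<omega> * y powr (1 / of_nat m)"
  have "y \<noteq> 0"
    using \<open>Re y > 0\<close> by auto
  have "(y powr (1 / of_nat m)) ^ m = y"
    using \<open>m \<ge> 2\<close> \<open>y \<noteq> 0\<close> by (simp add: powr_def flip: exp_of_nat_mult)
  then have s_power: "s ^ m = - y"
    by (simp add: s_def power_mult_distrib assms(5))
  have s_div: "s / y = \<omega> * y powr (1 / of_nat m - 1)"
    using \<open>y \<noteq> 0\<close> by (simp add: s_def powr_diff)
  have "(\<lambda>k. of_nat m * s ^ m / ((of_nat (Suc k) + x) ^ m - s ^ m)) sums
      (- (\<Sum>\<xi> | \<xi> ^ m = 1. \<xi> * s * Digamma (x - \<xi> * s + 1)))"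
    using assms(1,4) by (intro sums_inverse_power_diff) (auto simp: s_power eq_neg_iff_add_eq_0)
  from sums_divide[OF this, of "of_nat m * s ^ m"]
  have "(\<lambda>k. 1 / ((of_nat (Suc k) + x) ^ m + y)) sums
      (1 / of_nat m * ((\<Sum>\<xi> | \<xi> ^ m = 1. \<xi> * s * Digamma (x - \<xi> * s + 1)) / y))"
    using \<open>m \<ge> 2\<close> \<open>y \<noteq> 0\<close> by (simp add: s_power del: of_nat_Suc)
  also have "(\<Sum>\<xi> | \<xi> ^ m = 1. \<xi> * s * Digamma (x - \<xi> * s + 1)) / y =
      (\<Sum>\<xi> | \<xi> ^ m = 1. \<xi> * (s / y) * Digamma (x - \<xi> * s + 1))"
    by (simp add: sum_divide_distrib)
  finally show ?thesis
    unfolding s_div unfolding s_def by (simp only: mult.assoc)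
qed

end
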